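(* Let $h:\mathbb{N}\to\mathbb{C}$ be a multiplicative function with $h(p)\neq 0$ for every prime $p$, and let $n\ge 1$ be a non-prime integer. Suppose that $n$ is squarefree or that $h$ is completely multiplicative. Then $$\sum_{\substack{A\subseteq L_n\setminus\{1,n\}\\ A\neq\emptyset}}(-1)^{|A|-1}\,h(\gcd(A))=h(n)-\varphi_h(n),\qquad\text{where}\quad \varphi_h(n):=h(n)\prod_{\substack{p\mid n\\ p\text{ prime}}}\left(1-\frac{1}{h(p)}\right).$$ The requirement that $n$ is non-prime can be dropped if $L_n\setminus\{1,n\}$ is replaced by $L_n\setminus\{n\}$. Furthermore, if $n$ is not squarefree and $h$ is completely multiplicative, then the sum on the left-hand side (with either $L_n\setminus\{1,n\}$ or $L_n\setminus\{n\}$) can be restricted to those $A$ with $\gcd(A)>1$.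
   Context: $\mathbb{N}$ denotes the set of positive integers. A function $h:\mathbb{N}\to\mathbb{C}$ is multiplicative if $h(1)=1$ and $h(ab)=h(a)h(b)$ for any coprime $a,b\in\mathbb{N}$, and completely multiplicative if $h(1)=1$ and $h(ab)=h(a)h(b)$ for any $a,b\in\mathbb{N}$. $L_n$ denotes the set of positive divisors of $n$, and $\gcd(A)$ the greatest common divisor of the elements of $A$. (For $h=\mathrm{id}_{\mathbb{N}}$, $\varphi_h$ is Euler's totient function.) *)

theory Defs
  imports Complex_Main "HOL-Computational_Algebra.Squarefree"
begin

(* Arithmetic functions on the positive integers are functions on nat
   whose value at 0 is never constrained or used. *)

definition multiplicative :: "(nat \<Rightarrow> complex) \<Rightarrow> bool" where
  "multiplicative h \<longleftrightarrow>
     h 1 = 1 \<and> (\<forall>a b. a > 0 \<longrightarrow> b > 0 \<longrightarrow> coprime a b \<longrightarrow> h (a * b) = h a * h b)"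

definition completely_multiplicative :: "(nat \<Rightarrow> complex) \<Rightarrow> bool" where
  "completely_multiplicative h \<longleftrightarrow>
     h 1 = 1 \<and> (\<forall>a b. a > 0 \<longrightarrow> b > 0 \<longrightarrow> h (a * b) = h a * h b)"

definition divisors :: "nat \<Rightarrow> nat set" where
  "divisors n = {d. d > 0 \<and> d dvd n}"

definition totient_of :: "(nat \<Rightarrow> complex) \<Rightarrow> nat \<Rightarrow> complex" where
  "totient_of h n = h n * (\<Prod>p | prime p \<and> p dvd n. 1 - 1 / h p)"

end

theory Submission
  imports Defs
begin

text \<open>
  Write \<open>F(S)\<close> for the alternating sum of \<open>h (Gcd A)\<close> over the nonempty
  \<open>A \<subseteq> S\<close>. For an arbitrary function \<open>h\<close>, adding to \<open>S\<close> a divisor \<open>x\<close> of some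
  \<open>s \<in> S\<close> leaves \<open>F(S)\<close> unchanged: the new sets \<open>A\<close> all contain \<open>x\<close>, and
  inserting or removing \<open>s\<close> pairs them off with equal greatest common divisor
  and opposite sign. Hence \<open>F(S)\<close> depends only on the elements of \<open>S\<close> that are
  maximal for divisibility (\<open>gcd_sum_cofinal\<close>); this is a form of the crosscut
  theorem.

  The maximal proper divisors of \<open>n\<close> are the \<open>n / p\<close> with \<open>p\<close> a prime divisor
  of \<open>n\<close>, and none of them is \<open>1\<close> unless \<open>n\<close> is prime. So both sums over proper
  divisors reduce to the sum over sets of these \<open>n / p\<close>. The greatest common
  divisor of \<open>{n / p | p \<in> P}\<close> is \<open>n / \<Prod>P\<close> (\<open>Gcd_coatoms\<close>), and in both cases of
  the hypothesis \<open>h (n / \<Prod>P) = h n * (\<Prod>p\<in>P. 1 / h p)\<close>; expanding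
  \<open>\<Prod>p. 1 - 1 / h p\<close> over the prime divisors of \<open>n\<close> gives the right-hand side.

  The restriction to \<open>Gcd A > 1\<close> amounts to replacing \<open>h\<close> by the function that
  vanishes at \<open>1\<close> and agrees with \<open>h\<close> elsewhere. The reduction to the \<open>n / p\<close>
  holds for every function, hence for this one too, and when \<open>n\<close> is not
  squarefree it differs from the squarefree number \<open>\<Prod>P\<close>, so that every
  \<open>n / \<Prod>P\<close> exceeds \<open>1\<close>: the change of \<open>h\<close> is then invisible.
\<close>

section \<open>Alternating sums over greatest common divisors\<close>

definition gcd_sum :: "(nat \<Rightarrow> 'a::comm_ring_1) \<Rightarrow> nat set \<Rightarrow> 'a" where
  "gcd_sum h S = (\<Sum>A\<in>Pow S - {{}}. (-1) ^ (card A - 1) * h (Gcd A))"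

text \<open>If \<open>x\<close> is new, the sets containing \<open>x\<close> cancel in pairs \<open>A\<close>, \<open>insert s A\<close>,
  since \<open>x dvd s\<close> makes \<open>s\<close> irrelevant to \<open>gcd x (Gcd A)\<close>.\<close>

lemma gcd_sum_insert_dvd:
  assumes "finite S" "s \<in> S" "x dvd s"
  shows "gcd_sum h (insert x S) = gcd_sum h S"
proof (cases "x \<in> S")
  case True
  then show ?thesis by (simp add: insert_absorb)
next
  case False
  define R where "R = S - {s}"
  have S: "S = insert s R" and s: "s \<notin> R" and fR: "finite R" and x: "x \<notin> insert s R"
    using assms False by (auto simp: R_def)
  define f :: "nat set \<Rightarrow> 'a" where "f A = (-1) ^ (card A - 1) * h (Gcd A)" for A
  have cancel: "f (insert x (insert s B)) = - f (insert x B)" if "B \<in> Pow R" for B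
  proof -
    have "finite B" "s \<notin> B" "x \<notin> insert s B"
      using that fR s x by (auto intro: finite_subset)
    moreover have "Gcd (insert x (insert s B)) = Gcd (insert x B)"
      using assms(3) by (simp flip: gcd.assoc add: gcd_nat.absorb1)
    ultimately show ?thesis by (simp add: f_def)
  qed
  have inj_s: "inj_on (insert s) (Pow R)"
    using s by (force simp: inj_on_def)
  have inj_x: "inj_on (insert x) (Pow S)"
    using False by (force simp: inj_on_def)
  have "sum f (insert x ` Pow S) = (\<Sum>B\<in>Pow S. f (insert x B))"
    using inj_x by (simp add: sum.reindex)
  also have "\<dots> = (\<Sum>B\<in>Pow R. f (insert x B)) + (\<Sum>B\<in>insert s ` Pow R. f (insert x B))"
    unfolding S Pow_insert using s fR by (intro sum.union_disjoint) auto
  also have "(\<Sum>B\<in>insert s ` Pow R. f (insert x B)) = (\<Sum>B\<in>Pow R. - f (insert x B))"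
    using inj_s cancel by (simp add: sum.reindex)
  finally have new: "sum f (insert x ` Pow S) = 0"
    by (simp add: sum_negf)
  have "Pow (insert x S) - {{}} = (Pow S - {{}}) \<union> insert x ` Pow S"
    by (auto simp: Pow_insert)
  moreover have "sum f ((Pow S - {{}}) \<union> insert x ` Pow S)
      = sum f (Pow S - {{}}) + sum f (insert x ` Pow S)"
    using assms(1) False by (intro sum.union_disjoint) auto
  ultimately show ?thesis
    using new by (simp add: gcd_sum_def f_def)
qed

lemma gcd_sum_cofinal:
  assumes "finite T" "S \<subseteq> T" "\<And>t. t \<in> T \<Longrightarrow> \<exists>s\<in>S. t dvd s"
  shows "gcd_sum h T = gcd_sum h S"
proof -
  have "gcd_sum h (S \<union> D) = gcd_sum h S" if "finite D" "D \<subseteq> T" for D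
    using that
  proof (induction D)
    case (insert x D)
    obtain s where "s \<in> S" "x dvd s"
      using assms(3) insert.prems by auto
    moreover have "finite (S \<union> D)"
      using assms insert by (auto intro: finite_subset)
    ultimately have "gcd_sum h (insert x (S \<union> D)) = gcd_sum h (S \<union> D)"
      by (intro gcd_sum_insert_dvd) auto
    then show ?case using insert by simp
  qed simp
  from this[of T] show ?thesis
    using assms by (simp add: Un_absorb1)
qed

lemma gcd_sum_restrict:
  assumes "finite S"
  shows "gcd_sum (\<lambda>d. if Q d then h d else 0) S
    = (\<Sum>A | A \<subseteq> S \<and> A \<noteq> {} \<and> Q (Gcd A). (-1) ^ (card A - 1) * h (Gcd A))"
proof -
  have eq: "{A. A \<subseteq> S \<and> A \<noteq> {} \<and> Q (Gcd A)} = {A \<in> Pow S - {{}}. Q (Gcd A)}"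
    by auto
  then show ?thesis
    unfolding gcd_sum_def eq using assms
    by (simp only: sum.inter_filter finite_Diff finite_Pow_iff) (rule sum.cong, simp_all)
qed

section \<open>The maximal proper divisors\<close>

definition coatoms :: "nat \<Rightarrow> nat set" where
  "coatoms n = (\<lambda>p. n div p) ` prime_factors n"

lemma finite_divisors: "n > 0 \<Longrightarrow> finite (divisors n)"
  by (rule finite_subset[of _ "{..n}"]) (auto simp: divisors_def dvd_imp_le)

lemma coatoms_proper: "coatoms n \<subseteq> divisors n - {n}"
proof
  fix s assume "s \<in> coatoms n"
  then obtain p where p: "p \<in> prime_factors n" "s = n div p"
    by (auto simp: coatoms_def)
  then have "prime p" "n > 0" "n = p * s"
    by (auto simp: in_prime_factors_iff)
  moreover from this have "p > 1" by (blast intro: prime_gt_1_nat)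
  ultimately show "s \<in> divisors n - {n}"
    by (auto simp: divisors_def)
qed

lemma one_in_coatoms_iff: "1 \<in> coatoms n \<longleftrightarrow> prime n"
proof
  assume "1 \<in> coatoms n"
  then obtain p where p: "p \<in> prime_factors n" "1 = n div p"
    by (auto simp: coatoms_def)
  then have "n = n div p * p"
    by (simp add: in_prime_factors_iff)
  with p(2) have "n = p" by (metis mult_1)
  then show "prime n" using p by (auto simp: in_prime_factors_iff)
next
  assume "prime n"
  then have "n \<in> prime_factors n" "1 = n div n"
    by (auto simp: in_prime_factors_iff prime_gt_0_nat)
  then show "1 \<in> coatoms n" unfolding coatoms_def by blast
qed

lemma proper_divisor_dvd_coatom:
  assumes "n > 0" "d \<in> divisors n - {n}"
  shows "\<exists>s\<in>coatoms n. d dvd s"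
proof -
  obtain k where k: "n = d * k" using assms by (auto simp: divisors_def)
  with assms have "k \<noteq> 1" by auto
  then obtain p where "prime p" "p dvd k" using prime_factor_nat by blast
  then obtain l where l: "k = p * l" by blast
  have "n div p = d * l"
    using k l \<open>prime p\<close> by (simp add: prime_gt_0_nat)
  moreover have "p \<in> prime_factors n"
    using \<open>prime p\<close> assms(1) k l by (auto simp: in_prime_factors_iff)
  ultimately show ?thesis
    unfolding coatoms_def by force
qed

lemma coprime_prime_prod_primes:
  fixes p :: nat
  assumes "prime p" "p \<notin> P" "\<And>q. q \<in> P \<Longrightarrow> prime q"
  shows "coprime p (\<Prod>P)"
proof (rule prod_coprime_right)
  fix q assume "q \<in> P"
  with assms have "prime q" "p \<noteq> q" by auto
  with assms(1) show "coprime p q" by (rule primes_coprime)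
qed

lemma prod_primes_dvd:
  fixes n :: nat
  assumes "finite P" "P \<subseteq> prime_factors n"
  shows "\<Prod>P dvd n"
  using assms
proof (induction P)
  case (insert p P)
  have "coprime p (\<Prod>P)"
    using insert by (intro coprime_prime_prod_primes) auto
  then show ?case
    using insert by (simp add: divides_mult in_prime_factors_iff)
qed simp

text \<open>The inductive step: if \<open>n = p * m * k\<close> with \<open>p\<close> and \<open>m = \<Prod>P\<close> coprime, then
  \<open>gcd (n / p) (n / m) = gcd (m * k) (p * k) = k\<close>.\<close>

lemma Gcd_coatoms:
  fixes n :: nat
  assumes "finite P" "P \<noteq> {}" "P \<subseteq> prime_factors n"
  shows "Gcd ((\<lambda>p. n div p) ` P) = n div \<Prod>P"
  using assms
proof (induction P rule: finite_ne_induct)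
  case (insert p P)
  define m where "m = \<Prod>P"
  have "coprime p m"
    unfolding m_def using insert
    by (intro coprime_prime_prod_primes) auto
  obtain k where k: "n = p * m * k"
    using prod_primes_dvd[of "insert p P" n] insert by (auto simp: m_def)
  have "n > 0" using insert.prems by (auto simp: in_prime_factors_iff)
  then have "p > 0" "m > 0" using k by auto
  have "Gcd ((\<lambda>p. n div p) ` insert p P) = gcd (n div p) (n div m)"
    using insert by (simp add: m_def)
  also have "\<dots> = gcd (k * m) (k * p)"
    using k \<open>p > 0\<close> \<open>m > 0\<close> by (simp add: ac_simps)
  also have "\<dots> = k"
    using \<open>coprime p m\<close> by (simp add: gcd_mult_distrib_nat[symmetric] coprime_commute)
  also have "\<dots> = n div (p * m)"
    using k \<open>p > 0\<close> \<open>m > 0\<close> by simp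
  finally show ?case using insert by (simp add: m_def)
qed simp

lemma gcd_sum_coatoms:
  assumes "n > 0"
  shows "gcd_sum h (coatoms n)
    = (\<Sum>P\<in>Pow (prime_factors n) - {{}}. (-1) ^ (card P - 1) * h (n div \<Prod>P))"
proof -
  let ?c = "\<lambda>p. n div p" and ?Q = "prime_factors n"
  have inj: "inj_on ?c ?Q"
  proof (rule inj_onI)
    fix p q assume "p \<in> ?Q" "q \<in> ?Q" "n div p = n div q"
    moreover from this have "p * (n div p) = n" "q * (n div q) = n"
      by (auto simp: in_prime_factors_iff)
    ultimately have "p * (n div p) = q * (n div p)" by simp
    moreover have "n div p \<noteq> 0"
      using assms \<open>p * (n div p) = n\<close> by (intro notI) simp
    ultimately show "p = q" by simp
  qed
  have im: "image ?c ` (Pow ?Q - {{}}) = Pow (coatoms n) - {{}}"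
    unfolding coatoms_def image_Pow_surj[OF refl, symmetric] by auto
  have injI: "inj_on (image ?c) (Pow ?Q - {{}})"
    by (rule inj_on_subset[OF inj_on_image_Pow[OF inj]]) auto
  have "gcd_sum h (coatoms n)
      = (\<Sum>P\<in>Pow ?Q - {{}}. (-1) ^ (card (?c ` P) - 1) * h (Gcd (?c ` P)))"
    unfolding gcd_sum_def im[symmetric] using injI by (simp add: sum.reindex)
  also have "\<dots> = (\<Sum>P\<in>Pow ?Q - {{}}. (-1) ^ (card P - 1) * h (n div \<Prod>P))"
  proof (rule sum.cong)
    fix P assume "P \<in> Pow ?Q - {{}}"
    then have P: "finite P" "P \<noteq> {}" "P \<subseteq> ?Q"
      by (auto intro: finite_subset)
    have "card (?c ` P) = card P"
      by (intro card_image inj_on_subset[OF inj P(3)])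
    then show "(-1) ^ (card (?c ` P) - 1) * h (Gcd (?c ` P)) = (-1) ^ (card P - 1) * h (n div \<Prod>P)"
      using Gcd_coatoms[OF P] by simp
  qed simp
  finally show ?thesis .
qed

section \<open>Evaluation for multiplicative functions\<close>

lemma multiplicative_prod_primes:
  assumes "multiplicative h" "finite P" "\<And>p. p \<in> P \<Longrightarrow> prime p"
  shows "h (\<Prod>P) = (\<Prod>p\<in>P. h p)"
  using assms(2,3)
proof (induction P)
  case empty
  then show ?case using assms(1) by (simp add: multiplicative_def)
next
  case (insert p P)
  have "coprime p (\<Prod>P)"
    using insert by (intro coprime_prime_prod_primes) auto
  moreover have "p > 0" "\<Prod>P > 0"
    using insert by (auto intro!: prod_pos prime_gt_0_nat)
  ultimately have "h (p * \<Prod>P) = h p * h (\<Prod>P)"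
    using assms(1) by (simp add: multiplicative_def)
  then show ?case using insert by simp
qed

lemma squarefree_mult_imp_coprime:
  fixes a b :: nat
  assumes "squarefree (a * b)"
  shows "coprime a b"
proof -
  have "gcd a b ^ 2 dvd a * b"
    unfolding power2_eq_square by (intro mult_dvd_mono) auto
  then have "gcd a b dvd 1" by (rule squarefreeD[OF assms])
  then show ?thesis by (simp only: is_unit_gcd)
qed

text \<open>This is where the two alternatives meet: if \<open>n\<close> is squarefree, the factors
  \<open>n / \<Prod>P\<close> and \<open>\<Prod>P\<close> of \<open>n\<close> are coprime, so plain multiplicativity splits
  \<open>h n\<close>; otherwise complete multiplicativity does.\<close>

lemma multiplicative_div_prod_primes:
  assumes h: "multiplicative h" "\<And>p. prime p \<Longrightarrow> h p \<noteq> 0"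
    and n: "n > 0" "squarefree n \<or> completely_multiplicative h"
    and P: "P \<subseteq> prime_factors n"
  shows "h (n div \<Prod>P) = h n * (\<Prod>p\<in>P. 1 / h p)"
proof -
  have fin: "finite P" using P by (auto intro: finite_subset)
  define m where "m = \<Prod>P"
  have "m dvd n"
    unfolding m_def by (rule prod_primes_dvd[OF fin P])
  then obtain k where k: "n = k * m"
    by (auto simp: dvd_def mult.commute)
  then have pos: "k > 0" "m > 0" using n(1) by auto
  have "h n = h k * h m"
    using n(2) h(1) squarefree_mult_imp_coprime[of k m] pos
    unfolding k by (auto simp: multiplicative_def completely_multiplicative_def)
  moreover have hm: "h m = (\<Prod>p\<in>P. h p)"
    unfolding m_def using P by (intro multiplicative_prod_primes h fin) (auto simp: in_prime_factors_iff)
  moreover have "h m \<noteq> 0"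
    unfolding hm using P fin h(2) by (auto simp: in_prime_factors_iff)
  ultimately show ?thesis
    using k pos by (simp add: m_def[symmetric] prod_dividef)
qed

lemma gcd_sum_coatoms_eq_totient:
  assumes h: "multiplicative h" "\<And>p. prime p \<Longrightarrow> h p \<noteq> 0"
    and n: "n > 0" "squarefree n \<or> completely_multiplicative h"
  shows "gcd_sum h (coatoms n) = h n - totient_of h n"
proof -
  let ?Q = "prime_factors n"
  let ?t = "\<lambda>P. (-1) ^ card P * (\<Prod>p\<in>P. 1 / h p)"
  have "gcd_sum h (coatoms n) = (\<Sum>P\<in>Pow ?Q - {{}}. - (h n * ?t P))"
    unfolding gcd_sum_coatoms[OF n(1)]
  proof (rule sum.cong)
    fix P assume P: "P \<in> Pow ?Q - {{}}"
    then have "card P > 0" by (auto simp: card_gt_0_iff intro: finite_subset)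
    then obtain k where "card P = Suc k" using gr0_implies_Suc by blast
    then show "(-1) ^ (card P - 1) * h (n div \<Prod>P) = - (h n * ?t P)"
      using multiplicative_div_prod_primes[OF h n, of P] P by simp
  qed simp
  also have "\<dots> = h n - h n * (\<Sum>P\<in>Pow ?Q. ?t P)"
    by (simp add: sum.remove[of "Pow ?Q" "{}"] sum_negf sum_distrib_left algebra_simps)
  also have "(\<Sum>P\<in>Pow ?Q. ?t P) = (\<Prod>p\<in>?Q. 1 - 1 / h p)"
    by (simp add: prod_diff_conv_sum)
  also have "?Q = {p. prime p \<and> p dvd n}"
    using n(1) by (auto simp: in_prime_factors_iff)
  finally show ?thesis by (simp add: totient_of_def)
qed

lemma not_squarefree_div_prod_primes_gt_1:
  fixes n :: nat
  assumes "n > 0" "\<not> squarefree n" "P \<subseteq> prime_factors n"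
  shows "n div \<Prod>P > 1"
proof -
  have fin: "finite P" using assms(3) by (auto intro: finite_subset)
  have dvd: "\<Prod>P dvd n" by (rule prod_primes_dvd[OF fin assms(3)])
  have "squarefree (\<Prod>P)"
  proof (intro squarefree_prod_coprime)
    fix p q assume "p \<in> P" "q \<in> P" "p \<noteq> q"
    then show "coprime p q"
      using assms(3) by (intro primes_coprime) auto
  qed (use assms(3) in \<open>auto intro: squarefree_prime\<close>)
  moreover obtain k where k: "n = \<Prod>P * k" using dvd by blast
  ultimately have "k \<noteq> 1" using assms(2) by auto
  moreover have "k > 0" "\<Prod>P > 0" using k assms(1) by (auto simp del: prod_pos_nat_iff intro: gr0I)
  ultimately show ?thesis unfolding k by simp
qed

theorem mainTheorem8:
  fixes h :: "nat \<Rightarrow> complex" and n :: nat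
  assumes "multiplicative h"
    and "\<And>p. prime p \<Longrightarrow> h p \<noteq> 0"
    and "n \<ge> 1"
    and "squarefree n \<or> completely_multiplicative h"
  shows "(\<not> prime n \<longrightarrow>
            (\<Sum>A | A \<subseteq> divisors n - {1, n} \<and> A \<noteq> {}. (-1) ^ (card A - 1) * h (Gcd A))
              = h n - totient_of h n)
       \<and> (\<Sum>A | A \<subseteq> divisors n - {n} \<and> A \<noteq> {}. (-1) ^ (card A - 1) * h (Gcd A))
              = h n - totient_of h n
       \<and> (\<not> squarefree n \<and> completely_multiplicative h \<longrightarrow>
            (\<Sum>A | A \<subseteq> divisors n - {1, n} \<and> A \<noteq> {} \<and> Gcd A > 1.
                (-1) ^ (card A - 1) * h (Gcd A)) = h n - totient_of h n
          \<and> (\<Sum>A | A \<subseteq> divisors n - {n} \<and> A \<noteq> {} \<and> Gcd A > 1.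
                (-1) ^ (card A - 1) * h (Gcd A)) = h n - totient_of h n)"
proof -
  let ?h = "\<lambda>d. if d > 1 then h d else 0"
  have n: "n > 0" using assms(3) by simp
  have fin: "finite (divisors n - X)" for X
    using finite_divisors[OF n] by simp
  have all: "gcd_sum f (divisors n - {n}) = gcd_sum f (coatoms n)" for f :: "nat \<Rightarrow> complex"
    using fin coatoms_proper proper_divisor_dvd_coatom[OF n] by (intro gcd_sum_cofinal)
  have nontrivial: "gcd_sum f (divisors n - {1, n}) = gcd_sum f (coatoms n)"
    if "\<not> prime n" for f :: "nat \<Rightarrow> complex"
  proof (rule gcd_sum_cofinal[OF fin])
    show "coatoms n \<subseteq> divisors n - {1, n}"
      using coatoms_proper[of n] one_in_coatoms_iff[of n] that by auto
  qed (use proper_divisor_dvd_coatom[OF n] in auto)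
  have total: "gcd_sum h (coatoms n) = h n - totient_of h n"
    using gcd_sum_coatoms_eq_totient[OF assms(1,2) n assms(4)] .
  have unrestricted: "(\<Sum>A | A \<subseteq> S \<and> A \<noteq> {}. (-1) ^ (card A - 1) * h (Gcd A)) = gcd_sum h S" for S
    unfolding gcd_sum_def by (rule sum.cong) auto
  have restricted: "(\<Sum>A | A \<subseteq> S \<and> A \<noteq> {} \<and> Gcd A > 1. (-1) ^ (card A - 1) * h (Gcd A))
      = gcd_sum ?h S" if "finite S" for S
    using gcd_sum_restrict[OF that, of "\<lambda>d. d > 1" h] by simp
  have same: "gcd_sum ?h (coatoms n) = gcd_sum h (coatoms n)" if "\<not> squarefree n"
    unfolding gcd_sum_coatoms[OF n]
    using not_squarefree_div_prod_primes_gt_1[OF n that] by (intro sum.cong) auto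
  have "\<not> prime n" if "\<not> squarefree n"
    using that squarefree_prime by blast
  then show ?thesis
    unfolding unrestricted restricted[OF fin]
    using all nontrivial total same by simp
qed

end
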